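(* For every pair $(n,m)$, every randomized non-preemptive online algorithm for minimizing total flow time on $m$ identical machines (even knowing $n$ and $m$ in advance) has competitive ratio at least $\Gamma(n,m)$ on instances with at most $n$ jobs, where $\Gamma(n,m)=\Omega(\sqrt{n/m})$.
   Context: Online scheduling of jobs on $m$ identical machines. Each job $j$ has a release time $r_j\ge 0$ and a processing time $p_j>0$ (processing time $0$ allowed only if the paper's instances require it; here all are positive), and becomes known to the algorithm only at time $r_j$. Each machine processes at most one job at a time; in the non-preemptive model a started job runs to completion without interruption. The flow time of job $j$ is $C_j-r_j$; the objective is total flow time. For this lower bound, $\mathrm{OPT}(J)$ denotes the minimum total flow time over all offline non-preemptive schedules of $J$. A randomized algorithm has competitive ratio at least $\Gamma$ if for some instance $J$ its expected total flow time exceeds (a constant multiple of) $\Gamma\cdot\mathrm{OPT}(J)$; equivalently, no algorithm achieves $\mathbb{E}[F(\mathrm{ALG}(J))]\le c\,\Gamma\cdot\mathrm{OPT}(J)$ for all $J$ with a sufficiently small absolute constant $c$. *)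

theory Defs
  imports "HOL-Probability.Probability"
begin

text \<open>The number stored in a job carries no meaning: it only allows an instance, which is a
  set, to contain several jobs with the same release time and the same processing time.\<close>

datatype job = Job (job_id: nat) (release: real) (proc_time: real)

definition is_instance :: "nat \<Rightarrow> job set \<Rightarrow> bool" where
  "is_instance n J \<longleftrightarrow> finite J \<and> card J \<le> n \<and> (\<forall>j\<in>J. 0 \<le> release j \<and> 0 < proc_time j)"

text \<open>A non-preemptive schedule is determined by the machine and the start time of each job;
  only its values on the jobs of the instance at hand matter.\<close>

type_synonym schedule = "job \<Rightarrow> nat \<times> real"

abbreviation machine :: "schedule \<Rightarrow> job \<Rightarrow> nat" where
  "machine S j \<equiv> fst (S j)"

abbreviation start :: "schedule \<Rightarrow> job \<Rightarrow> real" where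
  "start S j \<equiv> snd (S j)"

definition completion :: "schedule \<Rightarrow> job \<Rightarrow> real" where
  "completion S j = start S j + proc_time j"

definition feasible :: "nat \<Rightarrow> job set \<Rightarrow> schedule \<Rightarrow> bool" where
  "feasible m J S \<longleftrightarrow>
     (\<forall>j\<in>J. machine S j < m \<and> release j \<le> start S j) \<and>
     (\<forall>j\<in>J. \<forall>k\<in>J. j \<noteq> k \<and> machine S j = machine S k \<longrightarrow>
        completion S j \<le> start S k \<or> completion S k \<le> start S j)"

definition total_flow :: "job set \<Rightarrow> schedule \<Rightarrow> real" where
  "total_flow J S = (\<Sum>j\<in>J. completion S j - release j)"

text \<open>For a finite instance and at least one machine the infimum is attained.\<close>

definition OPT :: "nat \<Rightarrow> job set \<Rightarrow> real" where
  "OPT m J = (INF S \<in> {S. feasible m J S}. total_flow J S)"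

definition revealed :: "real \<Rightarrow> job set \<Rightarrow> job set" where
  "revealed t J = {j\<in>J. release j \<le> t}"

type_synonym algorithm = "job set \<Rightarrow> schedule"

text \<open>A deterministic online algorithm for \<open>m\<close> machines and instances with at most \<open>n\<close> jobs.
  The second conjunct says that what is started up to time \<open>t\<close> (when, and on which machine)
  depends only on the jobs released up to time \<open>t\<close>.\<close>

definition online_algorithm :: "nat \<Rightarrow> nat \<Rightarrow> algorithm \<Rightarrow> bool" where
  "online_algorithm n m A \<longleftrightarrow>
     (\<forall>J. is_instance n J \<longrightarrow> feasible m J (A J)) \<and>
     (\<forall>J J' t. is_instance n J \<and> is_instance n J' \<and> revealed t J = revealed t J' \<longrightarrow>
        (\<forall>j\<in>revealed t J. start (A J) j \<le> t \<longrightarrow> A J' j = A J j))"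

text \<open>A randomized online algorithm is a probability distribution over deterministic ones, under
  which the schedule of every instance is a random variable. An algorithm that draws its random
  bits from an arbitrary probability space is covered by its image measure.\<close>

definition randomized_online_algorithm :: "nat \<Rightarrow> nat \<Rightarrow> algorithm measure \<Rightarrow> bool" where
  "randomized_online_algorithm n m R \<longleftrightarrow>
     prob_space R \<and>
     (\<forall>A\<in>space R. online_algorithm n m A) \<and>
     (\<forall>J. is_instance n J \<longrightarrow>
        (\<forall>j\<in>J. (\<lambda>A. A J j) \<in> measurable R (count_space UNIV \<Otimes>\<^sub>M borel)))"

text \<open>The expectation may be infinite, hence the nonnegative integral.\<close>

definition expected_flow :: "algorithm measure \<Rightarrow> job set \<Rightarrow> ennreal" where
  "expected_flow R J = (\<integral>\<^sup>+ A. ennreal (total_flow J (A J)) \<partial>R)"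

definition competitive_ratio_at_least :: "nat \<Rightarrow> nat \<Rightarrow> algorithm measure \<Rightarrow> real \<Rightarrow> bool" where
  "competitive_ratio_at_least n m R \<rho> \<longleftrightarrow>
     (\<exists>J. is_instance n J \<and> expected_flow R J > ennreal (\<rho> * OPT m J))"

end

theory Submission
  imports Defs
begin

text \<open>Proof idea: at time \<open>0\<close> release \<open>m\<close> jobs of length \<open>2 * Q\<close>. For an unknown \<open>i \<le> K\<close>, release
  \<open>m\<close> unit jobs at each of the times \<open>i * Q, \<dots>, i * Q + Q - 1\<close>. The optimum is at most
  \<open>5 * m * Q\<close>: either all big jobs are run before the stream of unit jobs, or all of them after it.
  A machine on which the algorithm starts its big job during the last \<open>Q\<close> time units before the
  stream is blocked throughout the stream and makes a backlog grow at unit rate, which costs about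
  \<open>Q\<^sup>2 / 2\<close>. Every big job is therefore either started before \<open>K * Q\<close> and costs \<open>Q\<^sup>2 / 2\<close> for one
  \<open>i\<close>, or it is delayed and costs \<open>K * Q\<close> for \<open>i = K\<close>. With \<open>Q = K\<^sup>2\<close> these balance when the
  instances \<open>i = 1, \<dots>, K\<close> get weight \<open>1\<close> each and \<open>K\<close> gets the additional weight \<open>K\<close>, so that
  some instance costs \<open>m * Q * K / 4\<close> in expectation, while \<open>n \<ge> m * (1 + K\<^sup>2)\<close> jobs suffice.\<close>

section \<open>Elementary facts on flow time and the optimum\<close>

lemma release_le_completion:
  assumes "feasible m J S" "j \<in> J" "0 < proc_time j"
  shows "release j \<le> completion S j"
  using assms unfolding feasible_def completion_def by force

lemma total_flow_nonneg:
  assumes "feasible m J S" "\<forall>j\<in>J. 0 < proc_time j"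
  shows "0 \<le> total_flow J S"
  unfolding total_flow_def using assms
  by (intro sum_nonneg) (simp add: release_le_completion)

lemma OPT_le_total_flow:
  assumes "feasible m J S" "\<forall>j\<in>J. 0 < proc_time j"
  shows "OPT m J \<le> total_flow J S"
  unfolding OPT_def
proof (rule cINF_lower)
  show "bdd_below (total_flow J ` {S. feasible m J S})"
    using total_flow_nonneg assms(2) by (intro bdd_belowI2[where m = 0]) blast
qed (use assms in simp)

section \<open>The family of hard instances\<close>

text \<open>The identifier \<open>k\<close>, here and in \<open>small_jobs\<close>, keeps equal jobs
  distinct and is reused as machine index in the offline schedule of
  \<open>OPT_hard_instance_le\<close>.\<close>

definition big_jobs :: "nat \<Rightarrow> nat \<Rightarrow> job set" where
  "big_jobs m Q = (\<lambda>k. Job k 0 (2 * real Q)) ` {..<m}"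

definition small_jobs :: "nat \<Rightarrow> nat \<Rightarrow> real \<Rightarrow> job set" where
  "small_jobs m Q a = (\<lambda>(k, q). Job k (a + real q) 1) ` ({..<m} \<times> {..<Q})"

definition hard_instance :: "nat \<Rightarrow> nat \<Rightarrow> nat \<Rightarrow> job set" where
  "hard_instance m Q i = big_jobs m Q \<union> small_jobs m Q (real i * real Q)"

lemma finite_big_jobs [simp]: "finite (big_jobs m Q)"
  and finite_small_jobs [simp]: "finite (small_jobs m Q a)"
  by (simp_all add: big_jobs_def small_jobs_def)

lemma card_big_jobs [simp]: "card (big_jobs m Q) = m"
  unfolding big_jobs_def by (subst card_image) (auto simp: inj_on_def)

lemma card_small_jobs [simp]: "card (small_jobs m Q a) = m * Q"
  unfolding small_jobs_def
  by (subst card_image) (auto simp: inj_on_def)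

text \<open>The processing times separate the two kinds: \<open>2 * Q\<close> is even, hence never
  1.\<close>

lemma big_small_disjoint: "big_jobs m Q \<inter> small_jobs m Q a = {}"
proof -
  have "real (2 * Q) \<noteq> real 1" by (simp only: of_nat_eq_iff) presburger
  then have "2 * real Q \<noteq> 1" by simp
  then show ?thesis by (auto simp: big_jobs_def small_jobs_def)
qed

lemma total_flow_hard_instance:
  "total_flow (hard_instance m Q i) S =
     total_flow (big_jobs m Q) S + total_flow (small_jobs m Q (real i * real Q)) S"
  unfolding hard_instance_def total_flow_def
  by (rule sum.union_disjoint) (simp_all add: big_small_disjoint)

lemma hard_instance_proc_time_pos:
  assumes "0 < Q" "j \<in> hard_instance m Q i"
  shows "0 < proc_time j"
  using assms by (auto simp: hard_instance_def big_jobs_def small_jobs_def)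

lemma hard_instance_is_instance:
  assumes "0 < Q" "m + m * Q \<le> n"
  shows "is_instance n (hard_instance m Q i)"
  using assms card_Un_le[of "big_jobs m Q" "small_jobs m Q (real i * real Q)"]
  by (auto simp: is_instance_def hard_instance_def)
     (auto simp: big_jobs_def small_jobs_def)

lemma big_jobs_is_instance:
  assumes "0 < Q" "m \<le> n"
  shows "is_instance n (big_jobs m Q)"
  using assms by (auto simp: is_instance_def) (auto simp: big_jobs_def)

section \<open>Backlog of unit jobs\<close>

text \<open>Unit jobs on one machine start at least one time unit apart, so the machine and the
  rounded-down start offset determine the job; \<open>m - card B\<close> machines and
  \<open>q\<close> offsets are available.\<close>

lemma card_unit_jobs_completed_le:
  assumes feas: "feasible m J S"
    and C: "C \<subseteq> J" "\<And>j. j \<in> C \<Longrightarrow> proc_time j = 1 \<and> a \<le> release j \<and> completion S j \<le> a + real q"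
    and B: "B \<subseteq> {..<m}" "\<And>j. j \<in> C \<Longrightarrow> machine S j \<notin> B"
  shows "card C \<le> (m - card B) * q"
proof -
  let ?f = "\<lambda>j. (machine S j, nat \<lfloor>start S j - a\<rfloor>)"
  have start: "a \<le> start S j" "start S j \<le> a + real q - 1" if "j \<in> C" for j
    using C feas that unfolding feasible_def completion_def by force+
  have inj: "inj_on ?f C"
  proof (rule inj_onI, rule ccontr)
    fix j k assume jk: "j \<in> C" "k \<in> C" "?f j = ?f k" "j \<noteq> k"
    then have "completion S j \<le> start S k \<or> completion S k \<le> start S j"
      using feas C(1) unfolding feasible_def by blast
    then have "start S j + 1 \<le> start S k \<or> start S k + 1 \<le> start S j"
      using C(2) jk by (simp add: completion_def)
    moreover have "\<lfloor>start S j - a\<rfloor> = \<lfloor>start S k - a\<rfloor>"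
      using jk start by (simp add: eq_nat_nat_iff)
    ultimately show False by linarith
  qed
  have "?f ` C \<subseteq> ({..<m} - B) \<times> {..<q}"
  proof
    fix x assume "x \<in> ?f ` C"
    then obtain j where j: "j \<in> C" "x = ?f j" by blast
    have "machine S j < m" using feas C(1) j unfolding feasible_def by blast
    moreover have "nat \<lfloor>start S j - a\<rfloor> < q"
      using start[OF j(1)] by linarith
    ultimately show "x \<in> ({..<m} - B) \<times> {..<q}" using j B by simp
  qed
  then have "card C \<le> card (({..<m} - B) \<times> {..<q})"
    using card_inj_on_le[OF inj] by blast
  then show ?thesis
    using B(1) finite_subset[OF B(1)] by (simp add: card_cartesian_product card_Diff_subset)
qed

text \<open>Used with \<open>p\<close> the release and \<open>x\<close> the completion of a unit
  job, both relative to \<open>a\<close>: the integer times at which the job is pending number at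
  most its flow time.\<close>

lemma card_grid_points_le:
  fixes x :: real
  assumes "real p \<le> x"
  shows "real (card {q \<in> {1..Q}. p < q \<and> real q < x}) \<le> x - real p"
proof -
  have "{q \<in> {1..Q}. p < q \<and> real q < x} \<subseteq> {p<..nat \<lfloor>x\<rfloor>}"
    by (auto simp: le_nat_floor)
  then have "card {q \<in> {1..Q}. p < q \<and> real q < x} \<le> card {p<..nat \<lfloor>x\<rfloor>}"
    by (intro card_mono) simp_all
  also have "\<dots> = nat \<lfloor>x\<rfloor> - p" by simp
  finally show ?thesis using assms by linarith
qed

text \<open>At each of the times \<open>a + q\<close> at least \<open>card B * q\<close> of the small jobs released so far are
  unfinished; the flow time is bounded below by summing this backlog over \<open>q\<close>.\<close>

lemma small_jobs_flow_ge:
  assumes feas: "feasible m J S" and sub: "small_jobs m Q a \<subseteq> J"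
    and B: "B \<subseteq> {..<m}"
      "\<And>j. j \<in> small_jobs m Q a \<Longrightarrow> completion S j \<le> a + real Q \<Longrightarrow> machine S j \<notin> B"
  shows "real (card B) * (real Q)\<^sup>2 / 2 \<le> total_flow (small_jobs m Q a) S"
proof -
  let ?J = "small_jobs m Q a"
  have bm: "card B \<le> m" using card_mono[OF _ B(1)] by simp
  \<comment> \<open>The strict bound on the release leaves the offsets below \<open>q\<close>, that
    is, the prefix \<open>small_jobs m q a\<close> of \<open>m * q\<close> jobs.\<close>
  define pend where "pend q = {j \<in> ?J. release j < a + real q \<and> a + real q < completion S j}" for q
  have pend: "card B * q \<le> card (pend q)" if q: "q \<in> {1..Q}" for q
  proof -
    define D where "D = {j \<in> ?J. completion S j \<le> a + real q}"
    have "card D \<le> (m - card B) * q"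
    proof (rule card_unit_jobs_completed_le[OF feas _ _ B(1)])
      show "D \<subseteq> J" using sub by (auto simp: D_def)
      show "proc_time j = 1 \<and> a \<le> release j \<and> completion S j \<le> a + real q" if "j \<in> D" for j
        using that by (auto simp: D_def small_jobs_def)
      show "machine S j \<notin> B" if "j \<in> D" for j
        using that q by (intro B(2)) (auto simp: D_def)
    qed
    moreover have "small_jobs m q a \<subseteq> D \<union> pend q"
      using q by (force simp: small_jobs_def D_def pend_def)
    then have "card (small_jobs m q a) \<le> card D + card (pend q)"
      by (rule order.trans[OF card_mono card_Un_le, rotated]) (simp add: D_def pend_def)
    ultimately have "m * q \<le> (m - card B) * q + card (pend q)" by simp
    moreover have "m * q = (m - card B) * q + card B * q"
      using bm by (simp flip: add_mult_distrib)
    ultimately show ?thesis by linarith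
  qed
  have gauss: "(\<Sum>q=1..Q. real q) = real Q * (real Q + 1) / 2"
    by (induction Q) (auto simp: field_simps)
  have "real (card B) * (real Q)\<^sup>2 / 2 \<le> real (card B) * (\<Sum>q=1..Q. real q)"
    unfolding gauss by (simp add: power2_eq_square field_simps)
  also have "\<dots> = (\<Sum>q=1..Q. real (card B * q))" by (simp add: sum_distrib_left)
  also have "\<dots> \<le> (\<Sum>q=1..Q. real (card (pend q)))"
    using pend by (intro sum_mono) (simp only: of_nat_le_iff)
  \<comment> \<open>Double counting: the backlog summed over times becomes, job by job, the number
    of grid times at which the job is pending.\<close>
  also have "\<dots> = (\<Sum>q=1..Q. \<Sum>j\<in>?J. if j \<in> pend q then 1 else 0)"
    by (intro sum.cong refl) (auto simp: pend_def simp flip: sum.inter_filter intro!: arg_cong[where f = card])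
  also have "\<dots> = (\<Sum>j\<in>?J. \<Sum>q=1..Q. if j \<in> pend q then 1 else 0)" by (rule sum.swap)
  also have "\<dots> \<le> (\<Sum>j\<in>?J. completion S j - release j)"
  proof (rule sum_mono)
    fix j assume j: "j \<in> ?J"
    then obtain p where p: "release j = a + real p" "proc_time j = 1" by (auto simp: small_jobs_def)
    have "release j \<le> completion S j"
      using sub j p by (intro release_le_completion[OF feas]) auto
    then have "real p \<le> completion S j - a" using p by simp
    from card_grid_points_le[OF this, of Q]
    have "real (card {q \<in> {1..Q}. p < q \<and> real q < completion S j - a}) \<le> completion S j - release j"
      using p by simp
    also have "{q \<in> {1..Q}. p < q \<and> real q < completion S j - a} = {q \<in> {1..Q}. j \<in> pend q}"
      using j p by (auto simp: pend_def)
    finally show "(\<Sum>q=1..Q. if j \<in> pend q then 1 else 0) \<le> completion S j - release j"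
      by (simp flip: sum.inter_filter)
  qed
  finally show ?thesis by (simp add: total_flow_def)
qed

section \<open>Costs forced on a fixed schedule\<close>

text \<open>A big job started at most \<open>Q\<close> before the stream still runs \<open>Q\<close>
  time units into it, because its length is \<open>2 * Q\<close>. The machines of these jobs form
  the set \<open>B\<close> of \<open>small_jobs_flow_ge\<close>.\<close>

lemma hard_instance_flow_ge_blocked:
  assumes feas: "feasible m (hard_instance m Q i) S" and "1 \<le> i" "0 < Q"
  shows "real (card {j \<in> big_jobs m Q. real (i - 1) * real Q \<le> start S j \<and> start S j < real i * real Q})
           * (real Q)\<^sup>2 / 2 \<le> total_flow (hard_instance m Q i) S"
proof -
  define a where "a = real i * real Q"
  define G where "G = {j \<in> big_jobs m Q. real (i - 1) * real Q \<le> start S j \<and> start S j < a}"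
  have G: "a - real Q \<le> start S j" "start S j < a" "completion S j = start S j + 2 * real Q"
      "j \<in> hard_instance m Q i" if "j \<in> G" for j
    using that \<open>1 \<le> i\<close>
    by (auto simp: G_def big_jobs_def completion_def hard_instance_def a_def of_nat_diff algebra_simps)
  have "inj_on (machine S) G"
  \<comment> \<open>Two such jobs cannot share a machine: their starts are less than
    \<open>Q\<close> apart, but each has length \<open>2 * Q\<close>.\<close>
  proof (rule inj_onI, rule ccontr)
    fix j k assume jk: "j \<in> G" "k \<in> G" "machine S j = machine S k" "j \<noteq> k"
    then have "completion S j \<le> start S k \<or> completion S k \<le> start S j"
      using feas G(4) unfolding feasible_def by blast
    then show False using G(1-3)[OF jk(1)] G(1-3)[OF jk(2)] \<open>0 < Q\<close> by linarith
  qed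
  then have card: "card (machine S ` G) = card G" by (rule card_image)
  have "real (card (machine S ` G)) * (real Q)\<^sup>2 / 2 \<le> total_flow (small_jobs m Q a) S"
  proof (rule small_jobs_flow_ge[OF feas])
    show "small_jobs m Q a \<subseteq> hard_instance m Q i" by (simp add: hard_instance_def a_def)
    show "machine S ` G \<subseteq> {..<m}" using feas G(4) unfolding feasible_def by auto
    fix j assume j: "j \<in> small_jobs m Q a" "completion S j \<le> a + real Q"
    have jJ: "j \<in> hard_instance m Q i" using j by (simp add: hard_instance_def a_def)
    have pr: "proc_time j = 1" "a \<le> release j" using j by (auto simp: small_jobs_def)
    have st: "a \<le> start S j" using feas jJ pr unfolding feasible_def by force
    \<comment> \<open>The blocking job ends no earlier than \<open>a + Q\<close>, so a unit job run
      after it would end too late.\<close>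
    show "machine S j \<notin> machine S ` G"
    proof
      assume "machine S j \<in> machine S ` G"
      then obtain g where g: "g \<in> G" "machine S j = machine S g" by blast
      have "j \<noteq> g" using G(2)[OF g(1)] st by auto
      then have "completion S j \<le> start S g \<or> completion S g \<le> start S j"
        using feas g jJ G(4) unfolding feasible_def by blast
      then show False using G(1-3)[OF g(1)] st pr j(2) by (auto simp: completion_def)
    qed
  qed
  moreover have "release j \<le> completion S j" if "j \<in> big_jobs m Q" for j
    using that release_le_completion[OF feas] hard_instance_proc_time_pos[OF \<open>0 < Q\<close>]
    by (simp add: hard_instance_def)
  then have "0 \<le> total_flow (big_jobs m Q) S"
    unfolding total_flow_def by (intro sum_nonneg) simp
  ultimately show ?thesis
    unfolding total_flow_hard_instance card unfolding G_def a_def by linarith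
qed

text \<open>Big jobs are released at time 0, so a start at \<open>t\<close> or later means a flow
  time of at least \<open>t\<close>; all other jobs contribute nonnegatively.\<close>

lemma hard_instance_flow_ge_delayed:
  assumes feas: "feasible m (hard_instance m Q i) S" and "0 < Q"
  shows "real (card {j \<in> big_jobs m Q. t \<le> start S j}) * t \<le> total_flow (hard_instance m Q i) S"
proof -
  let ?D = "{j \<in> big_jobs m Q. t \<le> start S j}"
  have sub: "?D \<subseteq> hard_instance m Q i" by (auto simp: hard_instance_def)
  have "real (card ?D) * t = (\<Sum>j\<in>?D. t)" by simp
  also have "\<dots> \<le> (\<Sum>j\<in>?D. completion S j - release j)"
    by (intro sum_mono) (auto simp: big_jobs_def completion_def)
  also have "\<dots> \<le> (\<Sum>j\<in>hard_instance m Q i. completion S j - release j)"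
    using sub release_le_completion[OF feas] hard_instance_proc_time_pos[OF \<open>0 < Q\<close>]
    by (intro sum_mono2) (auto simp: hard_instance_def)
  finally show ?thesis by (simp add: total_flow_def)
qed

section \<open>Upper bound on the optimum\<close>

lemma OPT_hard_instance_le:
  assumes "1 \<le> i" "0 < Q"
  shows "OPT m (hard_instance m Q i) \<le> 5 * real m * real Q"
proof -
  \<comment> \<open>For \<open>i = 1\<close> the stream occupies the time from \<open>Q\<close> to
    \<open>2 * Q\<close>, so the big jobs wait until \<open>2 * Q\<close>; for larger
    \<open>i\<close> they end at \<open>2 * Q\<close>, no later than the stream begins.\<close>
  define s0 where "s0 = (if i = 1 then 2 * real Q else 0)"
  define S :: schedule where
    "S j = (job_id j, if j \<in> big_jobs m Q then s0 else release j)" for j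
  let ?a = "real i * real Q"
  have big: "S j = (job_id j, s0)" "completion S j = s0 + 2 * real Q" "release j = 0" "job_id j < m"
    if "j \<in> big_jobs m Q" for j
    using that by (auto simp: S_def completion_def big_jobs_def)
  have small: "S j = (job_id j, release j)" "completion S j = release j + 1" "job_id j < m"
      "\<exists>q<Q. release j = ?a + real q"
    if "j \<in> small_jobs m Q ?a" for j
    using that big_small_disjoint[of m Q ?a] by (auto simp: S_def completion_def small_jobs_def)
  have cross: "completion S j \<le> start S k \<or> completion S k \<le> start S j"
    if jk: "j \<in> big_jobs m Q" "k \<in> small_jobs m Q ?a" for j k
  proof -
    obtain q where q: "q < Q" "release k = ?a + real q" using small(4)[OF jk(2)] by blast
    show ?thesis
    proof (cases "i = 1")
      case True
      then show ?thesis using big[OF jk(1)] small[OF jk(2)] q by (simp add: s0_def)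
    next
      case False
      then have "2 * real Q \<le> ?a" using assms by (intro mult_right_mono) auto
      then have "2 * real Q \<le> ?a + real q" by simp
      then show ?thesis using False big[OF jk(1)] small[OF jk(2)] q by (simp add: s0_def)
    qed
  qed
  have bb: "j = k" if "j \<in> big_jobs m Q" "k \<in> big_jobs m Q" "job_id j = job_id k" for j k
    using that by (auto simp: big_jobs_def)
  have ss: "completion S j \<le> start S k \<or> completion S k \<le> start S j"
    if jk: "j \<in> small_jobs m Q ?a" "k \<in> small_jobs m Q ?a" "job_id j = job_id k" "j \<noteq> k" for j k
  proof -
    obtain p q where pq: "j = Job (job_id j) (?a + real p) 1" "k = Job (job_id k) (?a + real q) 1"
      using jk(1,2) by (auto simp: small_jobs_def)
    then have "p \<noteq> q" using jk by metis
    then have "p + 1 \<le> q \<or> q + 1 \<le> p" by linarith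
    then have "real p + 1 \<le> real q \<or> real q + 1 \<le> real p" by linarith
    moreover have "release j = ?a + real p" "release k = ?a + real q"
      using pq by (metis job.sel(2))+
    ultimately show ?thesis using small[OF jk(1)] small[OF jk(2)] by auto
  qed
  have mach: "machine S j = job_id j" for j by (simp add: S_def)
  have "feasible m (hard_instance m Q i) S"
    unfolding feasible_def
  proof (intro conjI ballI impI)
    fix j assume "j \<in> hard_instance m Q i"
    then show "machine S j < m" "release j \<le> start S j"
      using big small by (auto simp: hard_instance_def s0_def)
  next
    fix j k assume jk: "j \<in> hard_instance m Q i" "k \<in> hard_instance m Q i"
      "j \<noteq> k \<and> machine S j = machine S k"
    then show "completion S j \<le> start S k \<or> completion S k \<le> start S j"
      unfolding hard_instance_def mach using cross[of j k] cross[of k j] bb ss by blast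
  qed
  moreover have "\<forall>j\<in>hard_instance m Q i. 0 < proc_time j"
    using hard_instance_proc_time_pos[OF \<open>0 < Q\<close>] by blast
  ultimately have "OPT m (hard_instance m Q i) \<le> total_flow (hard_instance m Q i) S"
    by (rule OPT_le_total_flow)
  also have "total_flow (big_jobs m Q) S = real m * (s0 + 2 * real Q)"
    by (simp add: total_flow_def big)
  then have "total_flow (hard_instance m Q i) S = real m * (s0 + 2 * real Q) + real m * real Q"
    by (simp add: total_flow_hard_instance) (simp add: total_flow_def small)
  also have "\<dots> \<le> real m * (4 * real Q) + real m * real Q"
    by (intro add_right_mono mult_left_mono) (auto simp: s0_def)
  finally show ?thesis by (simp add: algebra_simps)
qed

section \<open>Indistinguishability before the stream\<close>

lemma revealed_hard_instance:
  assumes "0 \<le> t" "t < real i * real Q"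
  shows "revealed t (hard_instance m Q i) = big_jobs m Q" "revealed t (big_jobs m Q) = big_jobs m Q"
  using assms by (auto simp: revealed_def hard_instance_def) (auto simp: small_jobs_def big_jobs_def)

text \<open>Before the stream of small jobs begins, the algorithm cannot distinguish the instance from the
  one that consists of the big jobs only.\<close>

lemma online_hard_instance_start:
  assumes on: "online_algorithm n m A" and n: "m + m * Q \<le> n" and "0 < Q" and j: "j \<in> big_jobs m Q"
  shows "start (A (big_jobs m Q)) j < real i * real Q \<Longrightarrow>
           A (hard_instance m Q i) j = A (big_jobs m Q) j"
    and "start (A (hard_instance m Q i)) j < real i * real Q \<Longrightarrow>
           A (hard_instance m Q i) j = A (big_jobs m Q) j"
proof -
  let ?H = "hard_instance m Q i" and ?B = "big_jobs m Q"
  have inst: "is_instance n ?H" "is_instance n ?B"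
    using hard_instance_is_instance big_jobs_is_instance n \<open>0 < Q\<close> by auto
  have rel: "release j = 0" and jH: "j \<in> ?H" using j by (auto simp: big_jobs_def hard_instance_def)
  have feas: "feasible m J (A J)" if "is_instance n J" for J
    using on that by (simp add: online_algorithm_def)
  \<comment> \<open>The online condition is applied at the moment when \<open>j\<close> starts in
    \<open>A J\<close>. Keeping \<open>J\<close> and \<open>J'\<close> general allows both
    directions below.\<close>
  have eq: "A J' j = A J j"
    if J: "is_instance n J" "is_instance n J'" and r: "revealed (start (A J) j) J = ?B"
      "revealed (start (A J) j) J' = ?B" for J J'
    using on J r j unfolding online_algorithm_def by (metis order.refl)
  have pos: "0 \<le> start (A ?B) j" "0 \<le> start (A ?H) j"
    using feas[OF inst(1)] feas[OF inst(2)] j jH rel unfolding feasible_def by force+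
  show "A ?H j = A ?B j" if "start (A ?B) j < real i * real Q"
    using eq[OF inst(2,1)] revealed_hard_instance[OF pos(1) that] by simp
  show "A ?H j = A ?B j" if "start (A ?H) j < real i * real Q"
    using eq[OF inst(1,2)] revealed_hard_instance[OF pos(2) that] by simp
qed

section \<open>Weighted averaging over the instances\<close>

text \<open>Each of the \<open>m\<close> big jobs accounts for at least \<open>Q\<^sup>2 / 2\<close>
  on the right: through the instance before whose stream it starts, or through the \<open>K\<close>
  extra copies of the last instance.\<close>

lemma online_flow_sum_ge:
  assumes on: "online_algorithm n m A" and n: "m + m * Q \<le> n" and Q: "Q = K\<^sup>2" "1 \<le> K"
  shows "real m * (real Q)\<^sup>2 / 2 \<le>
    (\<Sum>i=1..K. total_flow (hard_instance m Q i) (A (hard_instance m Q i))) +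
      real K * total_flow (hard_instance m Q K) (A (hard_instance m Q K))"
proof -
  let ?H = "hard_instance m Q" and ?B = "big_jobs m Q"
  \<comment> \<open>Start times are read off the run on the big jobs alone, so that one partition
    into \<open>X i\<close> and \<open>D\<close> serves all instances.\<close>
  let ?s = "start (A ?B)"
  define X where "X i = {j \<in> ?B. real (i - 1) * real Q \<le> ?s j \<and> ?s j < real i * real Q}" for i
  define D where "D = {j \<in> ?B. real K * real Q \<le> ?s j}"
  have Q0: "0 < Q" using Q by simp
  have feas: "feasible m J (A J)" if "is_instance n J" for J
    using on that by (simp add: online_algorithm_def)
  note feasH = feas[OF hard_instance_is_instance[OF Q0 n]]
  have feasB: "feasible m ?B (A ?B)" using feas big_jobs_is_instance[OF Q0] n by simp
  note start = online_hard_instance_start[OF on n Q0]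
  have early: "real (card (X i)) * (real Q)\<^sup>2 / 2 \<le> total_flow (?H i) (A (?H i))" if "i \<in> {1..K}" for i
  proof -
    \<comment> \<open>A start before \<open>i * Q\<close> is unchanged when the stream of instance
      \<open>i\<close> is added.\<close>
    have "X i \<subseteq> {j \<in> ?B. real (i - 1) * real Q \<le> start (A (?H i)) j \<and> start (A (?H i)) j < real i * real Q}"
      unfolding X_def using start(1) by force
    then have "card (X i) \<le>
        card {j \<in> ?B. real (i - 1) * real Q \<le> start (A (?H i)) j \<and> start (A (?H i)) j < real i * real Q}"
      by (rule card_mono[rotated]) simp
    then have "real (card (X i)) * (real Q)\<^sup>2 / 2 \<le>
        real (card {j \<in> ?B. real (i - 1) * real Q \<le> start (A (?H i)) j \<and> start (A (?H i)) j < real i * real Q})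
          * (real Q)\<^sup>2 / 2"
      by (intro divide_right_mono mult_right_mono) auto
    also have "\<dots> \<le> total_flow (?H i) (A (?H i))"
      using that by (intro hard_instance_flow_ge_blocked feasH Q0) simp
    finally show ?thesis .
  qed
  have late: "real (card D) * (real K * real Q) \<le> total_flow (?H K) (A (?H K))"
  proof -
    have "D \<subseteq> {j \<in> ?B. real K * real Q \<le> start (A (?H K)) j}"
    proof (clarsimp simp: D_def)
      fix j assume j: "j \<in> ?B" "real K * real Q \<le> ?s j"
      \<comment> \<open>By contraposition: an earlier start in the last instance would also occur in
        the run on the big jobs alone.\<close>
      show "real K * real Q \<le> start (A (?H K)) j"
        using start(2)[OF j(1), of K] j(2) by fastforce
    qed
    then have "card D \<le> card {j \<in> ?B. real K * real Q \<le> start (A (?H K)) j}"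
      by (rule card_mono[rotated]) simp
    then have "real (card D) * (real K * real Q) \<le>
        real (card {j \<in> ?B. real K * real Q \<le> start (A (?H K)) j}) * (real K * real Q)"
      by (intro mult_right_mono) auto
    also have "\<dots> \<le> total_flow (?H K) (A (?H K))"
      by (intro hard_instance_flow_ge_delayed feasH Q0)
    finally show ?thesis .
  qed
  have "?B \<subseteq> (\<Union>i\<in>{1..K}. X i) \<union> D"
  proof
    fix j assume j: "j \<in> ?B"
    then have s0: "0 \<le> ?s j" using feasB unfolding feasible_def by (force simp: big_jobs_def)
    \<comment> \<open>The slot containing the start; the shift by 1 reflects that slot
      \<open>i\<close> begins at \<open>(i - 1) * Q\<close>.\<close>
    define i where "i = nat \<lfloor>?s j / real Q\<rfloor> + 1"
    have "real (i - 1) \<le> ?s j / real Q" "?s j / real Q < real i"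
      using s0 unfolding i_def by (auto simp: field_simps intro!: of_nat_floor) linarith
    then have i: "real (i - 1) * real Q \<le> ?s j" "?s j < real i * real Q"
      using Q0 by (auto simp: field_simps)
    show "j \<in> (\<Union>i\<in>{1..K}. X i) \<union> D"
    proof (cases "real K * real Q \<le> ?s j")
      case False
      with i(1) have "real (i - 1) * real Q < real K * real Q" by linarith
      then have "i \<in> {1..K}" using Q0 by (auto simp: i_def)
      then show ?thesis using i j by (auto simp: X_def)
    qed (use j in \<open>simp add: D_def\<close>)
  qed
  then have "card ?B \<le> card ((\<Union>i\<in>{1..K}. X i) \<union> D)"
    by (intro card_mono) (auto simp: X_def D_def)
  also have "\<dots> \<le> (\<Sum>i=1..K. card (X i)) + card D"
    by (intro order.trans[OF card_Un_le] add_right_mono card_UN_le) simp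
  finally have "real m \<le> (\<Sum>i=1..K. real (card (X i))) + real (card D)"
    by (simp flip: of_nat_sum of_nat_add)
  then have "real m * ((real Q)\<^sup>2 / 2) \<le>
      ((\<Sum>i=1..K. real (card (X i))) + real (card D)) * ((real Q)\<^sup>2 / 2)"
    by (intro mult_right_mono) auto
  also have "\<dots> = (\<Sum>i=1..K. real (card (X i)) * (real Q)\<^sup>2 / 2) + real (card D) * (real Q)\<^sup>2 / 2"
    by (simp add: distrib_right sum_distrib_right sum_divide_distrib)
  also have "\<dots> \<le> (\<Sum>i=1..K. real (card (X i)) * (real Q)\<^sup>2 / 2) + real (card D) * (real Q)\<^sup>2"
    by simp
  \<comment> \<open>Here the choice \<open>Q = K\<^sup>2\<close> enters: \<open>K\<close> copies of
    the delay \<open>K * Q\<close> amount to \<open>Q\<^sup>2\<close>.\<close>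
  also have "real (card D) * (real Q)\<^sup>2 = real K * (real (card D) * (real K * real Q))"
    by (simp add: Q power2_eq_square)
  also have "(\<Sum>i=1..K. real (card (X i)) * (real Q)\<^sup>2 / 2) + real K * (real (card D) * (real K * real Q))
      \<le> (\<Sum>i=1..K. total_flow (?H i) (A (?H i))) + real K * total_flow (?H K) (A (?H K))"
    by (intro add_mono sum_mono mult_left_mono early late) auto
  finally show ?thesis by simp
qed

lemma total_flow_measurable:
  assumes "randomized_online_algorithm n m R" "is_instance n J"
  shows "(\<lambda>A. ennreal (total_flow J (A J))) \<in> borel_measurable R"
proof -
  have "(\<lambda>A. start (A J) j) \<in> borel_measurable R" if "j \<in> J" for j
    using assms that unfolding randomized_online_algorithm_def
    by (intro measurable_compose[OF _ measurable_snd]) blast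
  then show ?thesis unfolding total_flow_def completion_def by measurable
qed

text \<open>Allows strict inequalities between expectations to be summed in the averaging
  argument.\<close>

instance ennreal :: strict_ordered_comm_monoid_add ..

text \<open>The deterministic inequality is integrated over \<open>R\<close>. The weights add up to
  \<open>2 * K\<close>, so if every expectation were below \<open>m * Q * K / 4\<close>, the
  weighted sum would be below \<open>m * Q * K\<^sup>2 / 2 = m * Q\<^sup>2 / 2\<close>.\<close>

lemma expected_flow_hard_instance_ge:
  assumes R: "randomized_online_algorithm n m R" and n: "m + m * Q \<le> n" and Q: "Q = K\<^sup>2" "1 \<le> K"
  shows "\<exists>i\<in>{1..K}. ennreal (real m * real Q * real K / 4) \<le> expected_flow R (hard_instance m Q i)"
proof (rule ccontr)
  let ?H = "hard_instance m Q" and ?b = "real m * real Q * real K / 4"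
  assume "\<not> ?thesis"
  then have less: "expected_flow R (?H i) < ennreal ?b" if "i \<in> {1..K}" for i
    using that by (meson not_le)
  interpret prob_space R using R by (simp add: randomized_online_algorithm_def)
  have inst: "is_instance n (?H i)" for i
    using Q n by (intro hard_instance_is_instance) auto
  have on: "online_algorithm n m A" if "A \<in> space R" for A
    using R that by (simp add: randomized_online_algorithm_def)
  have nonneg: "0 \<le> total_flow (?H i) (A (?H i))" if "A \<in> space R" for A i
  proof (rule total_flow_nonneg)
    show "feasible m (?H i) (A (?H i))" using on[OF that] inst by (simp add: online_algorithm_def)
    show "\<forall>j\<in>?H i. 0 < proc_time j" using inst by (simp add: is_instance_def)
  qed
  have "ennreal (real m * (real Q)\<^sup>2 / 2) = (\<integral>\<^sup>+ A. ennreal (real m * (real Q)\<^sup>2 / 2) \<partial>R)"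
    by (simp add: emeasure_space_1)
  \<comment> \<open>The factor \<open>K\<close> is written as a sum of equal terms, so that both
    parts are integrated and compared termwise.\<close>
  also have "\<dots> \<le> (\<integral>\<^sup>+ A. (\<Sum>i=1..K. ennreal (total_flow (?H i) (A (?H i)))) +
      (\<Sum>i=1..K. ennreal (total_flow (?H K) (A (?H K)))) \<partial>R)"
  proof (rule nn_integral_mono)
    fix A assume A: "A \<in> space R"
    have "ennreal (real m * (real Q)\<^sup>2 / 2) \<le> ennreal ((\<Sum>i=1..K. total_flow (?H i) (A (?H i))) +
      real K * total_flow (?H K) (A (?H K)))"
      by (intro ennreal_leI online_flow_sum_ge[OF on[OF A] n Q])
    also have "\<dots> = (\<Sum>i=1..K. ennreal (total_flow (?H i) (A (?H i)))) +
      (\<Sum>i=1..K. ennreal (total_flow (?H K) (A (?H K))))"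
      using nonneg[OF A]
      by (simp add: sum_nonneg ennreal_mult ennreal_of_nat_eq_real_of_nat del: sum_ennreal)
         (simp add: sum_ennreal)
    finally show "ennreal (real m * (real Q)\<^sup>2 / 2) \<le> \<dots>" .
  qed
  also have "\<dots> = (\<Sum>i=1..K. expected_flow R (?H i)) + (\<Sum>i=1..K. expected_flow R (?H K))"
    unfolding expected_flow_def using total_flow_measurable[OF R inst]
    by (simp only: nn_integral_add nn_integral_sum borel_measurable_sum)
  also have "\<dots> < (\<Sum>i=1..K. ennreal ?b) + (\<Sum>i=1..K. ennreal ?b)"
    using Q less by (intro add_strict_mono sum_strict_mono) auto
  also have "\<dots> = ennreal (real m * (real Q)\<^sup>2 / 2)"
    by (simp add: ennreal_of_nat_eq_real_of_nat Q power2_eq_square field_simps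
        flip: ennreal_mult ennreal_plus)
  finally show False by simp
qed

section \<open>The competitive ratio\<close>

text \<open>A single unit job suffices. This covers the pairs for which \<open>n / m\<close> is too
  small for a hard instance.\<close>

lemma competitive_ratio_at_least_less_one:
  assumes R: "randomized_online_algorithm n m R" and "1 \<le> n" "1 \<le> m" "0 \<le> \<rho>" "\<rho> < 1"
  shows "competitive_ratio_at_least n m R \<rho>"
proof -
  let ?J = "{Job 0 0 1}"
  interpret prob_space R using R by (simp add: randomized_online_algorithm_def)
  have inst: "is_instance n ?J" using assms by (simp add: is_instance_def)
  have "OPT m ?J \<le> total_flow ?J (\<lambda>j. (0, 0))"
    using assms by (intro OPT_le_total_flow) (simp_all add: feasible_def)
  then have "\<rho> * OPT m ?J \<le> \<rho> * 1"
    using assms by (intro mult_left_mono) (simp_all add: total_flow_def completion_def)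
  then have "ennreal (\<rho> * OPT m ?J) < 1"
    using assms by (simp add: ennreal_less_one_iff)
  also have "1 = (\<integral>\<^sup>+ A. 1 \<partial>R)" by (simp add: emeasure_space_1)
  also have "\<dots> \<le> expected_flow R ?J"
    unfolding expected_flow_def
  proof (rule nn_integral_mono)
    fix A assume "A \<in> space R"
    then have "feasible m ?J (A ?J)"
      using R inst by (simp add: randomized_online_algorithm_def online_algorithm_def)
    then show "1 \<le> ennreal (total_flow ?J (A ?J))"
      by (simp add: feasible_def total_flow_def completion_def)
  qed
  finally show ?thesis using inst by (auto simp: competitive_ratio_at_least_def)
qed

lemma competitive_ratio_at_least_sqrt:
  assumes R: "randomized_online_algorithm n m R" and "1 \<le> n" "1 \<le> m"
  shows "competitive_ratio_at_least n m R (sqrt (real n / real m) / 100)"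
proof -
  \<comment> \<open>For \<open>n \<ge> m\<close> this is the largest \<open>K\<close> with
    \<open>m * (1 + K\<^sup>2) \<le> n\<close>; for \<open>n < m\<close> the root is negative and
    \<open>K = 0\<close>.\<close>
  define K where "K = nat \<lfloor>sqrt (real n / real m - 1)\<rfloor>"
  have m: "0 < real m" using assms by simp
  have bound: "real n / real m < (real K + 1)\<^sup>2 + 1"
  proof -
    have "sqrt (real n / real m - 1) < real K + 1" unfolding K_def by linarith
    then show ?thesis using real_sqrt_less_iff[of "real n / real m - 1" "(real K + 1)\<^sup>2"] by simp
  qed
  show ?thesis
  proof (cases "K = 0")
    case True
    \<comment> \<open>Here \<open>n / m < 2\<close>, so the claimed ratio is far below 1.\<close>
    then have "sqrt (real n / real m) < sqrt (100\<^sup>2)"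
      using bound by (intro real_sqrt_less_mono) simp
    then show ?thesis
      using assms by (intro competitive_ratio_at_least_less_one) simp_all
  next
    case False
    then have K1: "1 \<le> K" by simp
    define Q where "Q = K\<^sup>2"
    have "real K \<le> sqrt (real n / real m - 1)" using False unfolding K_def by linarith
    then have "(real K)\<^sup>2 \<le> (sqrt (real n / real m - 1))\<^sup>2" by (intro power_mono) auto
    moreover have "0 \<le> real n / real m - 1"
      using \<open>real K \<le> _\<close> K1 by (metis of_nat_0_le_iff order.trans real_sqrt_ge_0_iff)
    ultimately have "real Q + 1 \<le> real n / real m" by (simp add: Q_def)
    then have "real (m + m * Q) \<le> real n" using m by (simp add: field_simps)
    then have n: "m + m * Q \<le> n" by (simp only: of_nat_le_iff)
    obtain i where i: "i \<in> {1..K}"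
      "ennreal (real m * real Q * real K / 4) \<le> expected_flow R (hard_instance m Q i)"
      using expected_flow_hard_instance_ge[OF R n Q_def K1] by blast
    have Q0: "0 < Q" using K1 by (simp add: Q_def)
    \<comment> \<open>The factor 3 is generous:
      \<open>(K + 1)\<^sup>2 + 1 \<le> 5 * K\<^sup>2\<close> for \<open>K \<ge> 1\<close>.\<close>
    have "sqrt (real n / real m) \<le> sqrt ((3 * real K)\<^sup>2)"
    proof (rule real_sqrt_le_mono)
      have "1 \<le> real K" using K1 by simp
      then have "real K \<le> (real K)\<^sup>2" by (simp add: power2_eq_square)
      moreover have "(real K + 1)\<^sup>2 + 1 = (real K)\<^sup>2 + 2 * real K + 2" "(3 * real K)\<^sup>2 = 9 * (real K)\<^sup>2"
        by (simp_all add: power2_eq_square algebra_simps)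
      ultimately show "real n / real m \<le> (3 * real K)\<^sup>2"
        using \<open>1 \<le> real K\<close> bound by linarith
    qed
    also have "\<dots> = 3 * real K" by (rule real_sqrt_unique) simp_all
    finally have ratio: "sqrt (real n / real m) / 100 \<le> 3 * real K / 100" by simp
    have "sqrt (real n / real m) / 100 * OPT m (hard_instance m Q i)
        \<le> sqrt (real n / real m) / 100 * (5 * real m * real Q)"
      using i(1) Q0 by (intro mult_left_mono OPT_hard_instance_le) auto
    also have "\<dots> \<le> 3 * real K / 100 * (5 * real m * real Q)"
      using ratio by (intro mult_right_mono) auto
    \<comment> \<open>The constant 100 makes this strict:
      \<open>3 * 5 / 100 < 1 / 4\<close>.\<close>
    also have "\<dots> < real m * real Q * real K / 4"
      using m Q0 K1 by (simp add: field_simps)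
    finally have "ennreal (sqrt (real n / real m) / 100 * OPT m (hard_instance m Q i))
        < ennreal (real m * real Q * real K / 4)"
      using m Q0 K1 by (intro ennreal_lessI) auto
    with i(2) have "ennreal (sqrt (real n / real m) / 100 * OPT m (hard_instance m Q i))
        < expected_flow R (hard_instance m Q i)" by (rule less_le_trans[rotated])
    then show ?thesis
      using hard_instance_is_instance[OF Q0 n] by (auto simp: competitive_ratio_at_least_def)
  qed
qed

theorem mainTheorem3:
  "\<exists>\<Gamma> :: nat \<Rightarrow> nat \<Rightarrow> real.
     (\<exists>c>0. \<forall>n\<ge>1. \<forall>m\<ge>1. \<Gamma> n m \<ge> c * sqrt (real n / real m)) \<and>
     (\<forall>n\<ge>1. \<forall>m\<ge>1. \<forall>R. randomized_online_algorithm n m R \<longrightarrow>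
        competitive_ratio_at_least n m R (\<Gamma> n m))"
proof (intro exI[of _ "\<lambda>n m. sqrt (real n / real m) / 100"] conjI)
  show "\<exists>c>0. \<forall>n\<ge>1. \<forall>m\<ge>1. sqrt (real n / real m) / 100 \<ge> c * sqrt (real n / real m)"
    by (intro exI[of _ "1/100"]) simp
qed (use competitive_ratio_at_least_sqrt in blast)

end
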